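(* Let $n\ge 3$ and $m=(m_1,\ldots,m_n)$ with integers $m_i\ge 3$ for all $i=1,\ldots,n$. Let $d\in \operatorname{Der}(B_n^m)$ be a linear derivation. Then its associated matrix $[d]$ is diagonal and has the form $$[d]=\operatorname{diag}\left(\frac{\alpha}{m_1},\frac{\alpha}{m_2},\ldots,\frac{\alpha}{m_n}\right)$$ for some $\alpha\in\mathbb{C}$.
   Context: The Fermat ring is $B_n^m=\mathbb{C}[X_1,\ldots,X_n]/(X_1^{m_1}+\cdots+X_n^{m_n})$; $x_i$ denotes the residue class of $X_i$. $\operatorname{Der}(B_n^m)$ is the set of $\mathbb{C}$-derivations of $B_n^m$. A derivation $d$ of $B_n^m$ is called linear if there are $a_{ij}\in\mathbb{C}$ with $d(x_i)=\sum_{j=1}^n a_{ij}x_j$ for $i=1,\ldots,n$; the matrix $[d]=[a_{ij}]$ is called the associated matrix of $d$. *)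

theory Defs
  imports
    "HOL-Library.Poly_Mapping"
    "HOL-Algebra.Algebraic_Closure_Type"
    "HOL-Algebra.Module"
    "HOL-Analysis.Finite_Cartesian_Product"
begin

text \<open>
  Polynomials over the complex numbers in finitely many indeterminates \<open>Xvar i\<close>, \<open>i :: 'n\<close>, are
  finitely supported functions from exponent vectors to coefficients, with convolution as
  multiplication. The number of indeterminates is \<open>CARD('n)\<close>.
\<close>

type_synonym 'n cpoly = "('n \<Rightarrow>\<^sub>0 nat) \<Rightarrow>\<^sub>0 complex"

definition Xvar :: "'n \<Rightarrow> 'n cpoly" where
  "Xvar i = Poly_Mapping.single (Poly_Mapping.single i 1) 1"

definition Const :: "complex \<Rightarrow> 'n cpoly" where
  "Const c = Poly_Mapping.single 0 c"

abbreviation cpoly_ring :: "'n cpoly ring" where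
  "cpoly_ring \<equiv> ring_of_type_algebra"

definition fermat_poly :: "('n::finite \<Rightarrow> nat) \<Rightarrow> 'n cpoly" where
  "fermat_poly m = (\<Sum>i\<in>UNIV. Xvar i ^ m i)"

definition fermat_ideal :: "('n::finite \<Rightarrow> nat) \<Rightarrow> 'n cpoly set" where
  "fermat_ideal m = PIdl\<^bsub>cpoly_ring\<^esub> (fermat_poly m)"

definition residue_class :: "('n::finite \<Rightarrow> nat) \<Rightarrow> 'n cpoly \<Rightarrow> 'n cpoly set" where
  "residue_class m p = fermat_ideal m +>\<^bsub>cpoly_ring\<^esub> p"

text \<open>
  The quotient ring, equipped with the scalar multiplication that makes it an algebra over the
  complex numbers (see \<open>algebra_fermat_ring\<close> below).
\<close>

definition fermat_ring :: "('n::finite \<Rightarrow> nat) \<Rightarrow> (complex, 'n cpoly set) module" where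
  "fermat_ring m =
     ring.extend (cpoly_ring Quot fermat_ideal m)
       (module.fields (\<lambda>c b. residue_class m (Const c) \<otimes>\<^bsub>cpoly_ring Quot fermat_ideal m\<^esub> b))"

definition xbar :: "('n::finite \<Rightarrow> nat) \<Rightarrow> 'n \<Rightarrow> 'n cpoly set" where
  "xbar m i = residue_class m (Xvar i)"

text \<open>
  Derivations of an algebra \<open>A\<close> over \<open>K\<close>; the values outside the carrier are irrelevant.
\<close>

definition Der :: "('k, 'r) ring_scheme \<Rightarrow> ('k, 'a, 's) module_scheme \<Rightarrow> ('a \<Rightarrow> 'a) set" where
  "Der K A = {d. d \<in> carrier A \<rightarrow> carrier A
     \<and> (\<forall>a\<in>carrier A. \<forall>b\<in>carrier A. d (a \<oplus>\<^bsub>A\<^esub> b) = d a \<oplus>\<^bsub>A\<^esub> d b)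
     \<and> (\<forall>c\<in>carrier K. \<forall>a\<in>carrier A. d (c \<odot>\<^bsub>A\<^esub> a) = c \<odot>\<^bsub>A\<^esub> d a)
     \<and> (\<forall>a\<in>carrier A. \<forall>b\<in>carrier A.
          d (a \<otimes>\<^bsub>A\<^esub> b) = (d a \<otimes>\<^bsub>A\<^esub> b) \<oplus>\<^bsub>A\<^esub> (a \<otimes>\<^bsub>A\<^esub> d b))}"

abbreviation complex_field :: "complex ring" where
  "complex_field \<equiv> ring_of_type_algebra"

text \<open>
  The associated matrix is a relation, so that its uniqueness, which rests on the linear
  independence of the residue classes \<open>xbar m i\<close>, is not presupposed.
\<close>

definition has_associated_matrix ::
    "('n::finite \<Rightarrow> nat) \<Rightarrow> ('n cpoly set \<Rightarrow> 'n cpoly set) \<Rightarrow> complex^'n^'n \<Rightarrow> bool" where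
  "has_associated_matrix m d A \<longleftrightarrow>
     (\<forall>i. d (xbar m i) = (\<Oplus>\<^bsub>fermat_ring m\<^esub>j\<in>UNIV. (A $ i $ j) \<odot>\<^bsub>fermat_ring m\<^esub> xbar m j))"

definition linear_derivation ::
    "('n::finite \<Rightarrow> nat) \<Rightarrow> ('n cpoly set \<Rightarrow> 'n cpoly set) \<Rightarrow> bool" where
  "linear_derivation m d \<longleftrightarrow>
     d \<in> Der complex_field (fermat_ring m) \<and> (\<exists>A. has_associated_matrix m d A)"

definition diag :: "('n::finite \<Rightarrow> complex) \<Rightarrow> complex^'n^'n" where
  "diag f = (\<chi> i j. if i = j then f i else 0)"

lemma ideal_fermat_ideal: "ideal (fermat_ideal m) (cpoly_ring :: 'n::finite cpoly ring)"
proof -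
  interpret cring "cpoly_ring :: 'n cpoly ring" by (rule cring_from_type_algebra)
  show ?thesis
    unfolding fermat_ideal_def by (rule cgenideal_ideal) (simp add: ring_of_type_algebra_def)
qed

lemma fermat_ring_simps:
  "carrier (fermat_ring m) = carrier (cpoly_ring Quot fermat_ideal m)"
  "monoid.mult (fermat_ring m) = monoid.mult (cpoly_ring Quot fermat_ideal m)"
  "monoid.one (fermat_ring m) = monoid.one (cpoly_ring Quot fermat_ideal m)"
  "ring.zero (fermat_ring m) = ring.zero (cpoly_ring Quot fermat_ideal m)"
  "ring.add (fermat_ring m) = ring.add (cpoly_ring Quot fermat_ideal m)"
  "module.smult (fermat_ring m) =
     (\<lambda>c b. residue_class m (Const c) \<otimes>\<^bsub>cpoly_ring Quot fermat_ideal m\<^esub> b)"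
  by (simp_all add: fermat_ring_def ring.defs module.defs)

lemma cring_fermat_ring: "cring (fermat_ring m)"
proof -
  interpret I: ideal "fermat_ideal m" "cpoly_ring" by (rule ideal_fermat_ideal)
  interpret Q: cring "cpoly_ring Quot fermat_ideal m"
    by (rule I.quotient_is_cring) (rule cring_from_type_algebra)
  show ?thesis
  proof (rule cringI)
    show "abelian_group (fermat_ring m)"
      by (rule abelian_groupI)
        (auto simp: fermat_ring_simps Q.a_ac intro: Q.l_neg Q.a_inv_closed)
    show "comm_monoid (fermat_ring m)"
      by (rule comm_monoidI) (auto simp: fermat_ring_simps Q.m_ac)
  qed (auto simp: fermat_ring_simps Q.l_distr)
qed

lemma algebra_fermat_ring: "algebra complex_field (fermat_ring m)"
proof -
  interpret I: ideal "fermat_ideal m" "cpoly_ring" by (rule ideal_fermat_ideal)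
  interpret Q: cring "cpoly_ring Quot fermat_ideal m"
    by (rule I.quotient_is_cring) (rule cring_from_type_algebra)
  interpret h: ring_hom_ring cpoly_ring "cpoly_ring Quot fermat_ideal m" "residue_class m"
    using I.rcos_ring_hom_ring unfolding residue_class_def .
  have carr: "p \<in> carrier cpoly_ring" for p :: "'a cpoly"
    by (simp add: ring_of_type_algebra_def)
  have cl: "residue_class m p \<in> carrier (cpoly_ring Quot fermat_ideal m)" for p
    using h.hom_closed[OF carr] .
  have add: "residue_class m (Const (a + b)) = residue_class m (Const a)
      \<oplus>\<^bsub>cpoly_ring Quot fermat_ideal m\<^esub> residue_class m (Const b)" for a b
    using h.hom_add[OF carr carr, of "Const a" "Const b"]
    by (simp add: ring_of_type_algebra_def Const_def single_add)
  have mult: "residue_class m (Const (a * b)) = residue_class m (Const a)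
      \<otimes>\<^bsub>cpoly_ring Quot fermat_ideal m\<^esub> residue_class m (Const b)" for a b
    using h.hom_mult[OF carr carr, of "Const a" "Const b"]
    by (simp add: ring_of_type_algebra_def Const_def mult_single)
  have one: "residue_class m (Const 1) = \<one>\<^bsub>cpoly_ring Quot fermat_ideal m\<^esub>"
    using h.hom_one by (simp add: ring_of_type_algebra_def Const_def)
  show ?thesis
    by (rule algebraI[OF cring_from_type_algebra cring_fermat_ring])
      (auto simp: fermat_ring_simps cl ring_of_type_algebra_def[where 'a = complex]
        add mult one Q.l_distr Q.r_distr Q.m_assoc)
qed

end

theory Submission
  imports Defs "HOL-Computational_Algebra.Polynomial"
begin

text \<open>
  The coordinate ring \<open>B\<close> is studied through the points of the affine hypersurface
  \<open>\<Sum>\<^sub>i x\<^sub>i\<^bsup>m\<^sub>i\<^esup> = 0\<close>. Evaluation at such a point \<open>x\<close> factors through \<open>B\<close>, so composing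
  it with a derivation \<open>d\<close> of \<open>B\<close> gives a derivation of the polynomial ring at the point \<open>x\<close>
  (lemma \<open>derivation_at_zero\<close>) that kills the Fermat polynomial. By the Leibniz rule this says that
  the vector field \<open>x \<mapsto> A x\<close> attached to a linear \<open>d\<close> with matrix \<open>A = (a\<^sub>i\<^sub>j)\<close> is tangent to the
  hypersurface (lemma \<open>associated_matrix_tangency\<close>): at each of its points,
  \<open>\<Sum>\<^sub>i m\<^sub>i x\<^sub>i\<^bsup>m\<^sub>i - 1\<^esup> (A x)\<^sub>i = 0\<close>.

  It suffices to test this on the points with only two nonzero coordinates \<open>x\<^sub>i = 1\<close> and \<open>x\<^sub>j = t\<close>, where
  \<open>t\<close> is one of the \<open>m\<^sub>j\<close> roots of \<open>t\<^bsup>m\<^sub>j\<^esup> = -1\<close>. After multiplication by \<open>t\<close> the tangency condition becomes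
  a polynomial equation of degree at most two in \<open>t\<close> with coefficients \<open>- m\<^sub>j a\<^sub>j\<^sub>i\<close>,
  \<open>m\<^sub>i a\<^sub>i\<^sub>i - m\<^sub>j a\<^sub>j\<^sub>j\<close> and \<open>m\<^sub>i a\<^sub>i\<^sub>j\<close>. As \<open>m\<^sub>j \<ge> 3\<close>, it has at least three roots, so all coefficients vanish
  (lemma \<open>associated_matrix_pair\<close>): \<open>A\<close> is diagonal, and \<open>m\<^sub>i a\<^sub>i\<^sub>i\<close> is the same number \<open>\<alpha>\<close> for all \<open>i\<close>.
\<close>

section \<open>Evaluation of polynomials at a point\<close>

definition eval_at :: "('n::finite \<Rightarrow> complex) \<Rightarrow> 'n cpoly \<Rightarrow> complex" where
  "eval_at x p = Sum_any (\<lambda>e. Poly_Mapping.lookup p e * (\<Prod>i\<in>UNIV. x i ^ Poly_Mapping.lookup e i))"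

lemma eval_at_single:
  "eval_at x (Poly_Mapping.single e c) = c * (\<Prod>i\<in>UNIV. x i ^ Poly_Mapping.lookup e i)"
proof -
  have "eval_at x (Poly_Mapping.single e c)
      = Sum_any (\<lambda>e'. (if e' = e then c * (\<Prod>i\<in>UNIV. x i ^ Poly_Mapping.lookup e i) else 0))"
    unfolding eval_at_def by (rule Sum_any.cong) (simp add: lookup_single when_def)
  then show ?thesis by simp
qed

lemma eval_at_zero: "eval_at x 0 = 0"
  by (simp add: eval_at_def)

lemma eval_at_add: "eval_at x (p + q) = eval_at x p + eval_at x q"
  unfolding eval_at_def lookup_add distrib_right
  by (rule Sum_any.distrib; rule finite_subset[OF _ finite_lookup]) auto

text \<open>
  Building a polynomial one term at a time reduces an additive statement to monomials. Unlike
  \<open>update_induct\<close>, the step is a sum, which is the form that distributivity can use.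
\<close>

lemma poly_mapping_single_add_induct [case_names zero single_add]:
  assumes "P 0" and "\<And>e c p. P p \<Longrightarrow> P (Poly_Mapping.single e c + p)"
  shows "P p"
proof (induction p rule: Poly_Mapping.update_induct)
  case const
  show ?case by (rule assms(1))
next
  case (update f a b)
  have "Poly_Mapping.update a b f = Poly_Mapping.single a b + f"
    using update(1) by (intro poly_mapping_eqI)
      (auto simp: lookup_update lookup_add lookup_single when_def in_keys_iff)
  then show ?case using assms(2) update by simp
qed

lemma eval_at_mult: "eval_at x (p * q) = eval_at x p * eval_at x q"
proof -
  have single_single: "eval_at x (Poly_Mapping.single e c * Poly_Mapping.single e' c')
      = eval_at x (Poly_Mapping.single e c) * eval_at x (Poly_Mapping.single e' c')" for e e' c c'
    by (simp add: mult_single eval_at_single lookup_add power_add prod.distrib)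
  have "eval_at x (Poly_Mapping.single e c * q)
      = eval_at x (Poly_Mapping.single e c) * eval_at x q" for e c
    by (induction q rule: poly_mapping_single_add_induct)
      (simp_all add: eval_at_zero single_single distrib_left eval_at_add)
  then show ?thesis
    by (induction p rule: poly_mapping_single_add_induct)
      (simp_all add: eval_at_zero distrib_right eval_at_add)
qed

lemma eval_at_one: "eval_at x 1 = 1"
  using eval_at_single[of x 0 1] by simp

lemma eval_at_power: "eval_at x (p ^ k) = eval_at x p ^ k"
  by (induction k) (simp_all add: eval_at_mult eval_at_one)

lemma eval_at_sum: "eval_at x (sum f J) = (\<Sum>j\<in>J. eval_at x (f j))"
  by (induction J rule: infinite_finite_induct) (simp_all add: eval_at_add eval_at_zero)

lemma eval_at_Const: "eval_at x (Const c) = c"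
  by (simp add: Const_def eval_at_single)

lemma eval_at_Xvar: "eval_at x (Xvar i) = x i"
proof -
  have "(\<Prod>k\<in>UNIV. x k ^ Poly_Mapping.lookup (Poly_Mapping.single i (1::nat)) k)
      = (\<Prod>k\<in>UNIV. if k = i then x i else 1)"
    by (rule prod.cong) (auto simp: lookup_single when_def)
  then show ?thesis by (simp add: Xvar_def eval_at_single)
qed

lemma eval_at_fermat_poly: "eval_at x (fermat_poly m) = (\<Sum>i\<in>UNIV. x i ^ m i)"
  by (simp add: fermat_poly_def eval_at_sum eval_at_power eval_at_Xvar)

section \<open>Arithmetic of residue classes\<close>

lemma residue_class_hom:
  "ring_hom_ring cpoly_ring (cpoly_ring Quot fermat_ideal m) (residue_class m)"
  using ideal.rcos_ring_hom_ring[OF ideal_fermat_ideal] unfolding residue_class_def .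

lemma carrier_fermat_ring: "carrier (fermat_ring m) = range (residue_class m)"
  by (auto simp: fermat_ring_simps FactRing_def A_RCOSETS_def' residue_class_def
      ring_of_type_algebra_def)

lemma residue_class_add:
  "residue_class m p \<oplus>\<^bsub>fermat_ring m\<^esub> residue_class m q = residue_class m (p + q)"
  using ring_hom_add[OF ring_hom_ring.homh[OF residue_class_hom], of p q m]
  by (simp add: fermat_ring_simps ring_of_type_algebra_def)

lemma residue_class_mult:
  "residue_class m p \<otimes>\<^bsub>fermat_ring m\<^esub> residue_class m q = residue_class m (p * q)"
  using ring_hom_mult[OF ring_hom_ring.homh[OF residue_class_hom], of p q m]
  by (simp add: fermat_ring_simps ring_of_type_algebra_def)

lemma residue_class_smult:
  "c \<odot>\<^bsub>fermat_ring m\<^esub> residue_class m p = residue_class m (Const c * p)"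
  using residue_class_mult[of m "Const c" p] by (simp add: fermat_ring_simps)

lemma residue_class_zero: "residue_class m 0 = \<zero>\<^bsub>fermat_ring m\<^esub>"
proof -
  interpret cring "fermat_ring m" by (rule cring_fermat_ring)
  have "residue_class m 0 \<oplus>\<^bsub>fermat_ring m\<^esub> residue_class m 0 = residue_class m 0"
    by (simp add: residue_class_add)
  moreover have "residue_class m 0 \<in> carrier (fermat_ring m)"
    by (simp add: carrier_fermat_ring)
  ultimately show ?thesis by (simp add: add.l_cancel_one)
qed

lemma residue_class_sum:
  assumes "finite J"
  shows "(\<Oplus>\<^bsub>fermat_ring m\<^esub>j\<in>J. residue_class m (f j)) = residue_class m (sum f J)"
proof -
  interpret cring "fermat_ring m" by (rule cring_fermat_ring)
  show ?thesis
    using assms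
    by (induction J) (auto simp: residue_class_zero residue_class_add carrier_fermat_ring)
qed

lemma residue_class_eq_coset: "residue_class m p = {h * fermat_poly m + p |h. True}"
  by (auto simp: residue_class_def a_r_coset_def' fermat_ideal_def cgenideal_def
      ring_of_type_algebra_def)

text \<open>
  Meaningful only if \<open>x\<close> is a zero of the Fermat polynomial and \<open>S\<close> is a residue class: the
  value then does not depend on the representative that is chosen.
\<close>

definition eval_class :: "('n::finite \<Rightarrow> complex) \<Rightarrow> 'n cpoly set \<Rightarrow> complex" where
  "eval_class x S = eval_at x (SOME p. p \<in> S)"

lemma residue_class_fermat_poly: "residue_class m (fermat_poly m) = residue_class m 0"
proof -
  have "h * fermat_poly m + fermat_poly m = (h + 1) * fermat_poly m + 0"
    "h * fermat_poly m + 0 = (h - 1) * fermat_poly m + fermat_poly m" for h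
    by (simp_all add: algebra_simps)
  then show ?thesis unfolding residue_class_eq_coset by blast
qed

lemma eval_class_residue_class:
  assumes "eval_at x (fermat_poly m) = 0"
  shows "eval_class x (residue_class m p) = eval_at x p"
proof -
  have "p \<in> residue_class m p"
    unfolding residue_class_eq_coset by (auto intro: exI[of _ 0])
  then have "(SOME q. q \<in> residue_class m p) \<in> residue_class m p"
    by (rule someI)
  then show ?thesis
    using assms
    by (auto simp: eval_class_def residue_class_eq_coset eval_at_add eval_at_mult)
qed

section \<open>Derivations at a point of the hypersurface\<close>

text \<open>
  The complex numbers are regarded as a module on which a polynomial acts through its value at \<open>x\<close>.
  As the Fermat polynomial is a sum of powers of the indeterminates, the two rules already determine
  the value of \<open>D\<close> on it from the values on the indeterminates.
\<close>

locale point_derivation =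
  fixes x :: "'n::finite \<Rightarrow> complex" and D :: "'n cpoly \<Rightarrow> complex"
  assumes add: "D (p + q) = D p + D q"
    and leibniz: "D (p * q) = D p * eval_at x q + eval_at x p * D q"
begin

lemma sum: "D (sum f J) = (\<Sum>j\<in>J. D (f j))"
proof -
  have "D 0 = 0" using add[of 0 0] by simp
  then show ?thesis
    by (induction J rule: infinite_finite_induct) (simp_all add: add)
qed

lemma power: "D (p ^ k) = of_nat k * eval_at x p ^ (k - 1) * D p"
proof (induction k)
  case 0
  show ?case using leibniz[of 1 1] by (simp add: eval_at_one)
next
  case (Suc k)
  then show ?case
    by (cases k) (simp_all add: leibniz eval_at_mult eval_at_power algebra_simps)
qed

end

text \<open>
  The composite of reduction to the quotient, \<open>d\<close>, and evaluation at \<open>x\<close>. The two rules for \<open>d\<close> survive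
  because the last map is a ring homomorphism on the quotient when \<open>x\<close> is a zero of the Fermat
  polynomial.
\<close>

lemma derivation_at_zero:
  assumes d: "d \<in> Der complex_field (fermat_ring m)" and x: "eval_at x (fermat_poly m) = 0"
  shows "point_derivation x (\<lambda>p. eval_class x (d (residue_class m p)))"
proof
  fix p q :: "'a cpoly"
  have carr: "residue_class m r \<in> carrier (fermat_ring m)" for r
    by (simp add: carrier_fermat_ring)
  have "\<exists>r'. d (residue_class m r) = residue_class m r'" for r
  proof -
    have "d (residue_class m r) \<in> carrier (fermat_ring m)"
      using d carr by (auto simp: Der_def)
    then show ?thesis by (auto simp: carrier_fermat_ring)
  qed
  then obtain p' q' where d': "d (residue_class m p) = residue_class m p'"
    "d (residue_class m q) = residue_class m q'" by blast
  have "d (residue_class m (p + q)) = residue_class m (p' + q')"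
    using d carr unfolding residue_class_add[symmetric] d'[symmetric] by (simp add: Der_def)
  then show "eval_class x (d (residue_class m (p + q)))
      = eval_class x (d (residue_class m p)) + eval_class x (d (residue_class m q))"
    by (simp add: d' eval_class_residue_class[OF x] eval_at_add)
  have "d (residue_class m (p * q)) = residue_class m (p' * q + p * q')"
    using d carr unfolding residue_class_add[symmetric] residue_class_mult[symmetric] d'[symmetric]
    by (simp add: Der_def)
  then show "eval_class x (d (residue_class m (p * q)))
      = eval_class x (d (residue_class m p)) * eval_at x q
        + eval_at x p * eval_class x (d (residue_class m q))"
    by (simp add: d' eval_class_residue_class[OF x] eval_at_add eval_at_mult)
qed

text \<open>
  The Fermat polynomial and \<open>0\<close> have the same residue class, so the derivation at \<open>x\<close> induced by \<open>d\<close> kills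
  the Fermat polynomial. The left-hand side is the value on it that the Leibniz rule gives.
\<close>

lemma associated_matrix_tangency:
  fixes A :: "complex^'n^'n"
  assumes d: "d \<in> Der complex_field (fermat_ring m)" and A: "has_associated_matrix m d A"
    and x: "(\<Sum>i\<in>UNIV. x i ^ m i) = 0"
  shows "(\<Sum>i\<in>UNIV. of_nat (m i) * x i ^ (m i - 1) * (\<Sum>j\<in>UNIV. A $ i $ j * x j)) = 0"
proof -
  have F: "eval_at x (fermat_poly m) = 0" using x by (simp add: eval_at_fermat_poly)
  define D where "D p = eval_class x (d (residue_class m p))" for p
  interpret point_derivation x D
    unfolding D_def by (rule derivation_at_zero[OF d F])
  have DX: "D (Xvar i) = (\<Sum>j\<in>UNIV. A $ i $ j * x j)" for i
  proof -
    have "d (residue_class m (Xvar i)) = residue_class m (\<Sum>j\<in>UNIV. Const (A $ i $ j) * Xvar j)"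
      using A by (simp add: has_associated_matrix_def xbar_def residue_class_smult residue_class_sum)
    then show ?thesis
      by (simp add: D_def eval_class_residue_class[OF F] eval_at_sum eval_at_mult eval_at_Const
          eval_at_Xvar)
  qed
  have "D (fermat_poly m) = D 0"
    by (simp add: D_def residue_class_fermat_poly)
  also have "\<dots> = 0" using sum[of "\<lambda>_. 0" "{}"] by simp
  finally show ?thesis
    by (simp add: fermat_poly_def sum power eval_at_Xvar DX)
qed

section \<open>Points with two nonzero coordinates\<close>

lemma quadratic_three_roots:
  fixes a b c :: "'a::idom"
  assumes "\<And>t. t \<in> S \<Longrightarrow> a + b * t + c * t^2 = 0" and "card S \<ge> 3"
  shows "a = 0" "b = 0" "c = 0"
proof -
  have "[:a, b, c:] = 0"
  proof (rule ccontr)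
    assume nz: "[:a, b, c:] \<noteq> 0"
    have "S \<subseteq> {t. poly [:a, b, c:] t = 0}"
      using assms(1) by (auto simp: algebra_simps power2_eq_square)
    then have "card S \<le> card {t. poly [:a, b, c:] t = 0}"
      by (rule card_mono[OF poly_roots_finite[OF nz]])
    also have "\<dots> \<le> degree [:a, b, c:]"
      by (rule card_poly_roots_bound[OF nz])
    also have "\<dots> \<le> 2" by simp
    finally show False using assms(2) by simp
  qed
  then show "a = 0" "b = 0" "c = 0" by simp_all
qed

text \<open>
  At the points \<open>x\<^sub>i = 1\<close>, \<open>x\<^sub>j = t\<close> with \<open>t\<^bsup>m\<^sub>j\<^esup> = -1\<close> and all other coordinates zero, only the \<open>i\<close>-th and
  \<open>j\<close>-th terms of the tangency condition remain, as \<open>x\<^sub>k\<^bsup>m\<^sub>k - 1\<^esup> = 0\<close> for the other \<open>k\<close>. The identity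
  \<open>t\<^bsup>m\<^sub>j - 1\<^esup> = -1 / t\<close> turns it into a quadratic equation whose coefficients carry both claims, and
  there are \<open>m\<^sub>j \<ge> 3\<close> choices of \<open>t\<close>.
\<close>

lemma associated_matrix_pair:
  fixes A :: "complex^'n^'n"
  assumes d: "d \<in> Der complex_field (fermat_ring m)" and A: "has_associated_matrix m d A"
    and m: "\<And>k. m k \<ge> 3" and ij: "i \<noteq> j"
  shows "A $ i $ j = 0" "of_nat (m i) * A $ i $ i = of_nat (m j) * A $ j $ j"
proof -
  define S :: "complex set" where "S = {t. t ^ m j = -1}"
  define a where "a k l = A $ k $ l" for k l
  have m_pos: "m k > 0" "m k - 1 > 0" for k using m[of k] by simp_all
  have quadratic: "- (of_nat (m j) * a j i)
      + (of_nat (m i) * a i i - of_nat (m j) * a j j) * t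
      + (of_nat (m i) * a i j) * t^2 = 0" if "t \<in> S" for t
  proof -
    have t: "t ^ m j = -1" using that by (simp add: S_def)
    define x where "x k = (if k = i then 1 else if k = j then t else 0)" for k
    have two: "(\<Sum>k\<in>UNIV. f k) = f i + f j" if "\<And>k. k \<noteq> i \<Longrightarrow> k \<noteq> j \<Longrightarrow> f k = 0"
      for f :: "'n \<Rightarrow> complex"
    proof -
      have "(\<Sum>k\<in>UNIV. f k) = (\<Sum>k\<in>{i, j}. f k)"
        by (rule sum.mono_neutral_right) (use that in auto)
      then show ?thesis using ij by simp
    qed
    have "(\<Sum>k\<in>UNIV. x k ^ m k) = 0"
      using ij t m_pos by (subst two) (simp_all add: x_def)
    then have "(\<Sum>k\<in>UNIV. of_nat (m k) * x k ^ (m k - 1) * (\<Sum>l\<in>UNIV. a k l * x l)) = 0"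
      unfolding a_def by (rule associated_matrix_tangency[OF d A])
    moreover have "(\<Sum>l\<in>UNIV. a k l * x l) = a k i + a k j * t" for k
      using ij by (subst two) (simp_all add: x_def)
    ultimately have "(\<Sum>k\<in>UNIV. of_nat (m k) * x k ^ (m k - 1) * (a k i + a k j * t)) = 0"
      by simp
    moreover have "(\<Sum>k\<in>UNIV. of_nat (m k) * x k ^ (m k - 1) * (a k i + a k j * t))
        = of_nat (m i) * (a i i + a i j * t)
          + of_nat (m j) * t ^ (m j - 1) * (a j i + a j j * t)"
      using ij m_pos by (subst two) (simp_all add: x_def)
    \<comment> \<open>The factor \<open>t\<close> completes \<open>t ^ (m j - 1)\<close> to \<open>t ^ m j\<close>, whose value is known.\<close>
    ultimately have "t * (of_nat (m i) * (a i i + a i j * t)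
          + of_nat (m j) * t ^ (m j - 1) * (a j i + a j j * t)) = 0"
      by simp
    then have "t * (of_nat (m i) * (a i i + a i j * t))
        + of_nat (m j) * (t * t ^ (m j - 1)) * (a j i + a j j * t) = 0"
      by (simp only: distrib_left mult.assoc mult.left_commute[of t])
    moreover have "t * t ^ (m j - 1) = -1"
      using t m_pos(1)[of j] by (metis power_minus_mult mult.commute)
    ultimately have "t * (of_nat (m i) * (a i i + a i j * t))
        + of_nat (m j) * (-1) * (a j i + a j j * t) = 0"
      by (simp only:)
    moreover have "t * (of_nat (m i) * (a i i + a i j * t))
        + of_nat (m j) * (-1) * (a j i + a j j * t)
      = - (of_nat (m j) * a j i)
        + (of_nat (m i) * a i i - of_nat (m j) * a j j) * t
        + (of_nat (m i) * a i j) * t^2"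
      by (simp add: algebra_simps power2_eq_square)
    ultimately show ?thesis by (simp only:)
  qed
  have "card S = m j"
    unfolding S_def using m_pos(1)[of j] by (intro card_nth_roots) simp_all
  then have "card S \<ge> 3" using m[of j] by simp
  from quadratic_three_roots(2,3)[OF quadratic this]
  have "of_nat (m i) * a i i - of_nat (m j) * a j j = 0" "of_nat (m i) * a i j = 0"
    by simp_all
  then show "A $ i $ j = 0" "of_nat (m i) * A $ i $ i = of_nat (m j) * A $ j $ j"
    using m_pos(1)[of i] by (simp_all add: a_def)
qed

theorem theorem5:
  fixes m :: "'n::finite \<Rightarrow> nat"
    and d :: "'n cpoly set \<Rightarrow> 'n cpoly set"
    and A :: "complex^'n^'n"
  assumes "CARD('n) \<ge> 3"
    and "\<And>i. m i \<ge> 3"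
    and "linear_derivation m d"
    and "has_associated_matrix m d A"
  shows "\<exists>\<alpha>. A = diag (\<lambda>i. \<alpha> / of_nat (m i))"
proof -
  have d: "d \<in> Der complex_field (fermat_ring m)"
    using assms(3) by (simp add: linear_derivation_def)
  note pair = associated_matrix_pair[OF d assms(4,2)]
  obtain k :: 'n where True by simp
  define \<alpha> where "\<alpha> = of_nat (m k) * A $ k $ k"
  have "A $ i $ i = \<alpha> / of_nat (m i)" for i
  proof -
    have "of_nat (m i) * A $ i $ i = \<alpha>"
      using pair(2)[of i k] by (cases "i = k") (simp_all add: \<alpha>_def)
    then show ?thesis using assms(2)[of i] by (auto simp: field_simps)
  qed
  then have "A = diag (\<lambda>i. \<alpha> / of_nat (m i))"
    by (simp add: vec_eq_iff diag_def pair(1))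
  then show ?thesis by blast
qed

end
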